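(* Let $(A,B)\in\mathbb{R}^{n\times n}\times\mathbb{R}^{n\times m}$ be strictly stabilizable and let $\mathcal{C}$ be a proper $C$-set in $\mathbb{R}^{n+m}$. There exists a unique proper $C$-set $\mathcal{P}_\infty$ in $\mathbb{R}^n$ solving the fixed point set-equation $$\mathcal{P}=P_x\left(\mathcal{C}^*\oplus (A\ B)^T\mathcal{P}^*\right)^*.$$ Furthermore, the set $\mathcal{P}_\infty$ is an asymptotically stable attractor for the set-dynamics $$\mathcal{P}^+=P_x\left(\mathcal{C}^*\oplus (A\ B)^T\mathcal{P}^*\right)^*,$$ and the domain of attraction, in terms of the polar sets $\mathcal{P}^*$, is the space of $C$-sets in $\mathbb{R}^n$.
   Context: A set in $\mathbb{R}^d$ is a $C$-set if it is compact, convex and contains the origin; it is a proper $C$-set if moreover it contains the origin in its interior. For a set $\mathcal{X}\subseteq\mathbb{R}^d$ with $0\in\mathcal{X}$, its polar set is $\mathcal{X}^*:=\{x\in\mathbb{R}^d : y^Tx\le 1\ \text{for all } y\in\mathcal{X}\}$. Minkowski sum: $\mathcal{X}\oplus\mathcal{Y}:=\{x+y : x\in\mathcal{X},\ y\in\mathcal{Y}\}$. For a matrix $M$, $M\mathcal{X}:=\{Mx : x\in\mathcal{X}\}$. $(A\ B)$ is the $n\times(n+m)$ block matrix; $P_x$ is the projection $(x,u)\mapsto x$ from $\mathbb{R}^{n+m}=\mathbb{R}^n\times\mathbb{R}^m$ to $\mathbb{R}^n$. $(A,B)$ is strictly stabilizable if the uncontrollable part of the system $x^+=Ax+Bu$ is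 strictly stable, equivalently, if there is $K\in\mathbb{R}^{m\times n}$ such that the spectral radius of $A+BK$ is strictly less than $1$. Iterates of the set-dynamics: the initial condition is specified through its polar set, a $C$-set $\mathcal{P}_0^*\subset\mathbb{R}^n$ (so $\mathcal{P}_0=(\mathcal{P}_0^* )^*$ may be unbounded, e.g. when $\mathcal{P}_0^*=\{0\}$), and $\mathcal{P}_{k+1}=P_x(\mathcal{C}^*\oplus(A\ B)^T\mathcal{P}_k^* )^*$ for all integers $k\ge 0$, where $\mathcal{P}_k^*$ is the polar set of $\mathcal{P}_k$. Convergence of sequences of nonempty convex compact sets is with respect to the Hausdorff distance. Asymptotically stable attractor with the stated domain of attraction means, as usual: (attractivity) for every $C$-set $\mathcal{P}_0^*$ in $\mathbb{R}^n$, the iterates $\mathcal{P}_k$, $k\ge1$, converge to $\mathcal{P}_\infty$ in the Hausdorff distance as $k\to\infty$; and (stability) for every $\varepsilon>0$ there is $\delta>0$ such that if the initial condition $\mathcal{P}_0$ is a proper $C$-set within Hausdorff distance $\delta$ of $\mathcal{P}_\infty$, then all iterates $\mathcal{P}_k$ are within Hausdorff distance $\varepsilon$ of $\mathcal{P}_\infty$. *)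

theory Defs
  imports "HOL-Analysis.Analysis"
begin

definition C_set :: "'a::euclidean_space set \<Rightarrow> bool" where
  "C_set S \<longleftrightarrow> compact S \<and> convex S \<and> 0 \<in> S"

definition proper_C_set :: "'a::euclidean_space set \<Rightarrow> bool" where
  "proper_C_set S \<longleftrightarrow> C_set S \<and> 0 \<in> interior S"

definition polar :: "'a::real_inner set \<Rightarrow> 'a set" where
  "polar S = {x. \<forall>y\<in>S. y \<bullet> x \<le> 1}"

(* Both suprema are over nonempty bounded-above sets whenever S and T are
   nonempty and bounded. *)
definition hausdorff_dist :: "'a::metric_space set \<Rightarrow> 'a set \<Rightarrow> real" where
  "hausdorff_dist S T = max (SUP x\<in>S. infdist x T) (SUP y\<in>T. infdist y S)"

definition convex_body :: "'a::euclidean_space set \<Rightarrow> bool" where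
  "convex_body S \<longleftrightarrow> compact S \<and> convex S \<and> S \<noteq> {}"

(* Convergence in the metric space of nonempty convex compact sets; that the sets belong to
   this space is part of the claim. *)
definition hausdorff_converges :: "(nat \<Rightarrow> 'a::euclidean_space set) \<Rightarrow> 'a set \<Rightarrow> bool" where
  "hausdorff_converges S T \<longleftrightarrow>
     (\<forall>k. convex_body (S k)) \<and> convex_body T \<and> (\<lambda>k. hausdorff_dist (S k) T) \<longlonglongrightarrow> 0"

definition complex_eigenvalues :: "real^'n^'n \<Rightarrow> complex set" where
  "complex_eigenvalues M =
     {z. \<exists>v::complex^'n. v \<noteq> 0 \<and> map_matrix complex_of_real M *v v = z *s v}"

(* The set of complex eigenvalues is finite and nonempty, so the supremum is a maximum. *)
definition spectral_radius :: "real^'n^'n \<Rightarrow> real" where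
  "spectral_radius M = (SUP z\<in>complex_eigenvalues M. cmod z)"

definition strictly_stabilizable :: "real^'n^'n \<Rightarrow> real^'m^'n \<Rightarrow> bool" where
  "strictly_stabilizable A B \<longleftrightarrow> (\<exists>K::real^'n^'m. spectral_radius (A + B ** K) < 1)"

(* The transpose of the block matrix (A B), with R^(n+m) taken as the product R^n x R^m
   (whose inner product is the Euclidean one). *)
definition block_transpose :: "real^'n^'n \<Rightarrow> real^'m^'n \<Rightarrow> real^'n \<Rightarrow> (real^'n) \<times> (real^'m)" where
  "block_transpose A B y = (transpose A *v y, transpose B *v y)"

(* The projection is applied after the outer polar, which is taken in R^n x R^m;
   the sum of sets is the Minkowski sum. *)
definition set_dynamics ::
    "real^'n^'n \<Rightarrow> real^'m^'n \<Rightarrow> ((real^'n) \<times> (real^'m)) set \<Rightarrow> (real^'n) set \<Rightarrow> (real^'n) set" where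
  "set_dynamics A B C P = fst ` polar (polar C + block_transpose A B ` polar P)"

(* The initial condition is polar Q with Q a C-set, so it may be unbounded; only the
   iterates from index 1 on are required to be compact. *)
definition attractive_for_C_set_polars ::
    "('a::euclidean_space set \<Rightarrow> 'a set) \<Rightarrow> 'a set \<Rightarrow> bool" where
  "attractive_for_C_set_polars F T \<longleftrightarrow>
     (\<forall>Q. C_set Q \<longrightarrow> hausdorff_converges (\<lambda>k. (F ^^ Suc k) (polar Q)) T)"

definition lyapunov_stable :: "('a::euclidean_space set \<Rightarrow> 'a set) \<Rightarrow> 'a set \<Rightarrow> bool" where
  "lyapunov_stable F T \<longleftrightarrow>
     (\<forall>\<epsilon>>0. \<exists>\<delta>>0. \<forall>P. proper_C_set P \<and> hausdorff_dist P T < \<delta> \<longrightarrow>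
        (\<forall>k. hausdorff_dist ((F ^^ k) P) T < \<epsilon>))"

end

theory Submission
  imports Defs "HOL-Computational_Algebra.Fundamental_Theorem_Algebra"
begin

text \<open>
  Polarity turns the dynamics into the map \<open>Q \<mapsto> {y. (y, 0) \<in> C\<^sup>* + (A B)\<^sup>T Q}\<close> on C-sets; on support
  functions this is value iteration \<open>V(x) \<mapsto> min\<^sub>u (g(x, u) + V(A x + B u))\<close> for the positively
  homogeneous stage cost \<open>g\<close> given by the gauge of \<open>C\<close>. A stabilizing feedback bounds the iterates
  of \<open>{0}\<close>, which increase, and the closure of their union is a fixed point \<open>Q\<close>. As some \<open>m Q \<times> {0}\<close>
  with \<open>m > 0\<close> lies in \<open>C\<^sup>*\<close> (the stage cost dominates \<open>m V\<close>), each step sends the inclusions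
  \<open>(1 - b) Q \<subseteq> Q' \<subseteq> (1 + a) Q\<close> to the same inclusions with \<open>a\<close> and \<open>b\<close> multiplied by \<open>1 - m\<close>.
  Every C-set \<open>Q'\<close> satisfies such inclusions with \<open>b = 1\<close> and \<open>a\<close> large, which gives attractivity and
  uniqueness; small \<open>a\<close> and \<open>b\<close> give stability.
\<close>

section \<open>Powers of a matrix of spectral radius less than one\<close>

text \<open>The vector p(G) v. Powers of \<open>G\<close> enter only through the orbit of
  \<open>v\<close>, so no matrix polynomial has to be formed.\<close>

definition poly_act :: "complex poly \<Rightarrow> complex^'n^'n \<Rightarrow> complex^'n \<Rightarrow> complex^'n" where
  "poly_act p G v = (\<Sum>i\<le>degree p. coeff p i *s ((*v) G ^^ i) v)"

lemma poly_act_eq: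
  assumes "degree p \<le> N"
  shows "poly_act p G v = (\<Sum>i\<le>N. coeff p i *s ((*v) G ^^ i) v)"
  unfolding poly_act_def
  by (rule sum.mono_neutral_left) (use assms in \<open>auto simp: coeff_eq_0\<close>)

lemma matrix_funpow_linear:
  fixes G :: "'a::field^'n^'n"
  shows "((*v) G ^^ i) (a *s x + y) = a *s ((*v) G ^^ i) x + ((*v) G ^^ i) y"
  by (induction i) (simp_all add: matrix_vector_right_distrib matrix_vector_mult_scaleR vec.scale vec.add)

lemma poly_act_root_factor:
  fixes v :: "complex^'n"
  shows "poly_act ([:-z, 1:] * q) G v = poly_act q G (G *v v - z *s v)"
proof -
  let ?N = "degree q"
  have deg: "degree ([:-z, 1:] * q) \<le> Suc ?N"
    using degree_mult_le[of "[:-z, 1:]" q] by simp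
  have lin: "((*v) G ^^ i) (G *v v - z *s v) = ((*v) G ^^ Suc i) v - z *s ((*v) G ^^ i) v" for i
    using matrix_funpow_linear[where G = G and i = i and a = "-z" and x = v and y = "G *v v"] by (simp add: funpow_swap1)
  have "poly_act ([:-z, 1:] * q) G v
      = (\<Sum>i\<le>Suc ?N. coeff (pCons 0 q) i *s ((*v) G ^^ i) v)
        - (\<Sum>i\<le>Suc ?N. (z * coeff q i) *s ((*v) G ^^ i) v)"
    unfolding poly_act_eq[OF deg] by (simp add: sum_subtractf vec.scale_left_diff_distrib
      algebra_simps flip: sum.distrib del: funpow.simps sum.atMost_Suc)
  \<comment> \<open>The index shift drops the constant coefficient of \<open>pCons 0 q\<close>,
    which is 0; the top term of the second sum vanishes because \<open>Suc ?N\<close> exceeds the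
    degree of \<open>q\<close>.\<close>
  also have "\<dots> = (\<Sum>i\<le>?N. coeff q i *s ((*v) G ^^ Suc i) v)
        - (\<Sum>i\<le>?N. (z * coeff q i) *s ((*v) G ^^ i) v)"
    by (subst sum.atMost_Suc_shift) (simp add: coeff_eq_0 del: funpow.simps)
  also have "\<dots> = poly_act q G (G *v v - z *s v)"
    unfolding poly_act_def lin
    by (simp add: vec.scale_right_diff_distrib sum_subtractf mult.commute del: funpow.simps)
  finally show ?thesis .
qed

text \<open>q(G) commutes with G - z because every power of G does. Together with the factorization
  above, p(G) v = 0 then says that q(G) v is zero or an eigenvector for z.\<close>

lemma poly_act_diff:
  "poly_act q G (G *v v - z *s v) = G *v poly_act q G v - z *s poly_act q G v"
proof -
  have lin: "((*v) G ^^ i) (G *v v - z *s v) = G *v ((*v) G ^^ i) v - z *s ((*v) G ^^ i) v" for i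
    using matrix_funpow_linear[where G = G and i = i and a = "-z" and x = v and y = "G *v v"] by (simp add: funpow_swap1)
  show ?thesis
    unfolding poly_act_def lin vec.sum vec.scale_sum_right
    by (simp add: sum_subtractf vec.scale vec.scale_right_diff_distrib mult.commute)
qed

lemma norm_vector_scalar_mult:
  fixes v :: "complex^'n"
  shows "norm (z *s v) = cmod z * norm v"
  by (simp add: norm_vec_def vector_scalar_mult_def norm_mult L2_set_right_distrib)

text \<open>Summing the recursion bounds a partial sum of \<open>f\<close> by \<open>f 0\<close>,
  plus \<open>c\<close> times itself, plus \<open>suminf g\<close>. As c < 1, this can be solved for
  the partial sum.\<close>

lemma summable_affine_recursion:
  fixes f g :: "nat \<Rightarrow> real"
  assumes "summable g" "0 \<le> c" "c < 1" "\<And>k. 0 \<le> f k" "\<And>k. 0 \<le> g k"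
    "\<And>k. f (Suc k) \<le> c * f k + g k"
  shows "summable f"
proof (rule bounded_imp_summable)
  fix n
  have "(\<Sum>k\<le>n. f k) \<le> f 0 + c * (\<Sum>k\<le>n. f k) + (\<Sum>k\<le>n. g k)"
  proof -
    have "(\<Sum>k\<le>n. f k) \<le> (\<Sum>k\<le>Suc n. f k)" using assms(4) by simp
    also have "\<dots> = f 0 + (\<Sum>k\<le>n. f (Suc k))" by (rule sum.atMost_Suc_shift)
    also have "\<dots> \<le> f 0 + (\<Sum>k\<le>n. c * f k + g k)"
      by (intro add_left_mono sum_mono assms)
    finally show ?thesis by (simp add: sum.distrib sum_distrib_left)
  qed
  also have "(\<Sum>k\<le>n. g k) \<le> suminf g" by (rule sum_le_suminf) (use assms in auto)
  finally have "(1 - c) * (\<Sum>k\<le>n. f k) \<le> f 0 + suminf g" by (simp add: algebra_simps)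
  then show "(\<Sum>k\<le>n. f k) \<le> (f 0 + suminf g) / (1 - c)"
    using assms(3) by (simp add: pos_le_divide_eq mult.commute)
qed (use assms in auto)

text \<open>The n + 1 vectors v, G v, ..., G^n v of an n-dimensional space are linearly dependent;
  the coefficients of a relation form the polynomial.\<close>

lemma annihilating_poly_exists:
  fixes v :: "complex^'n"
  obtains p where "p \<noteq> 0" "poly_act p G v = 0"
proof -
  let ?n = "CARD('n)" and ?w = "\<lambda>i. ((*v) G ^^ i) v"
  obtain c :: "nat \<Rightarrow> complex" where c: "\<exists>i\<le>?n. c i \<noteq> 0" "(\<Sum>i\<le>?n. c i *s ?w i) = 0"
  proof (cases "inj_on ?w {..?n}")
    case True
    have "vec.dependent (?w ` {..?n})"
    proof (rule ccontr)
      assume "\<not> ?thesis"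
      then have "card (?w ` {..?n}) \<le> vec.dim (UNIV :: (complex^'n) set)"
        by (intro vec.independent_card_le_dim) auto
      then show False using True by (simp add: card_image card_cart_basis)
    qed
    then obtain u where u: "\<exists>x\<in>?w ` {..?n}. u x \<noteq> 0" "(\<Sum>x\<in>?w ` {..?n}. u x *s x) = 0"
      by (auto simp: vec.dependent_finite)
    show ?thesis
      by (rule that[of "\<lambda>i. u (?w i)"]) (use u sum.reindex[OF True, of "\<lambda>x. u x *s x"] in auto)
  next
    case False
    then obtain i j where ij: "i \<le> ?n" "j \<le> ?n" "i \<noteq> j" "?w i = ?w j"
      by (auto simp: inj_on_def)
    \<comment> \<open>Dependence is a property of sets, which does not see repeated vectors; a
      repetition in the orbit gives a relation with coefficients 1 and -1 directly.\<close>
    define c :: "nat \<Rightarrow> complex" where "c k = (if k = i then 1 else 0) - (if k = j then 1 else 0)" for k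
    have "(\<Sum>k\<le>?n. c k *s ?w k)
        = (\<Sum>k\<le>?n. if k = i then ?w k else 0) - (\<Sum>k\<le>?n. if k = j then ?w k else 0)"
      unfolding c_def sum_subtractf[symmetric] by (intro sum.cong) auto
    also have "\<dots> = 0" using ij by simp
    finally show ?thesis using ij by (intro that[of c]) (auto simp: c_def)
  qed
  define p where "p = (\<Sum>i\<le>?n. monom (c i) i)"
  have coeff: "coeff p i = (if i \<le> ?n then c i else 0)" for i
    by (simp add: p_def coeff_sum)
  then have "p \<noteq> 0" using c(1) by (metis coeff_0)
  moreover have "degree p \<le> ?n" by (rule degree_le) (simp add: coeff)
  then have "poly_act p G v = 0"
    unfolding poly_act_eq[OF \<open>degree p \<le> ?n\<close>] using c(2) by (simp add: coeff)
  ultimately show ?thesis by (rule that)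
qed

text \<open>
  Split off a linear factor \<open>G - z\<close>: if \<open>\<bar>z\<bar> < 1\<close>, the orbit of \<open>v\<close> obeys a contracting recursion driven
  by the orbit of \<open>(G - z) v\<close>; otherwise \<open>G - z\<close> is injective and the factor can be dropped.
\<close>

lemma summable_matrix_powers_if_annihilated:
  assumes "\<And>z. z \<in> Z \<Longrightarrow> cmod z < 1"
    and "\<And>z u. G *v u = z *s u \<Longrightarrow> u \<noteq> 0 \<Longrightarrow> z \<in> Z"
    and "p \<noteq> 0" "poly_act p G v = 0"
  shows "summable (\<lambda>k. norm (((*v) G ^^ k) v))"
  using assms(3,4)
proof (induction "degree p" arbitrary: p v)
  case 0
  then obtain c where "p = [:c:]" "c \<noteq> 0" by (metis degree_eq_zeroE pCons_0_0)
  then have "v = 0" using 0 by (simp add: poly_act_def)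
  moreover have "((*v) G ^^ k) 0 = 0" for k by (induction k) auto
  ultimately show ?case by simp
next
  case (Suc d)
  then obtain z where "poly p z = 0"
    using fundamental_theorem_of_algebra constant_degree by (metis nat.distinct(1))
  then obtain q where q: "p = [:-z, 1:] * q" using poly_eq_0_iff_dvd by (metis dvdE)
  with Suc.prems(1) have q0: "q \<noteq> 0" by auto
  then have dq: "d = degree q"
    using Suc.hyps(2) degree_mult_eq[of "[:-z, 1:]" q] unfolding q by simp
  define w where "w = G *v v - z *s v"
  have qw: "poly_act q G w = 0" using Suc.prems(2) unfolding w_def q poly_act_root_factor .
  show ?case
  proof (cases "cmod z < 1")
    case True
    have sw: "summable (\<lambda>k. norm (((*v) G ^^ k) w))" using Suc.hyps(1) dq q0 qw by blast
    have "((*v) G ^^ Suc k) v = z *s ((*v) G ^^ k) v + ((*v) G ^^ k) w" for k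
      using matrix_funpow_linear[where G = G and i = k and a = z and x = v and y = w] by (simp add: w_def funpow_swap1)
    then have "norm (((*v) G ^^ Suc k) v) \<le> cmod z * norm (((*v) G ^^ k) v) + norm (((*v) G ^^ k) w)" for k
      by (metis norm_triangle_ineq norm_vector_scalar_mult)
    then show ?thesis using True by (intro summable_affine_recursion[OF sw, of "cmod z"]) auto
  next
    case False
    have "G *v poly_act q G v = z *s poly_act q G v" using qw by (simp add: w_def poly_act_diff)
    then have "poly_act q G v = 0" using assms(1,2) False by blast
    then show ?thesis using Suc.hyps(1) dq q0 by blast
  qed
qed

text \<open>A bound on the operator norm bounds all eigenvalues, so the supremum in
  \<open>spectral_radius\<close> is over a set bounded above.\<close>

lemma cmod_eigenvalue_le_spectral_radius:
  assumes "z \<in> complex_eigenvalues M"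
  shows "cmod z \<le> spectral_radius M"
proof -
  let ?G = "map_matrix complex_of_real M"
  have "bounded_linear ((*v) ?G)" by (rule matrix_vector_mul_bounded_linear)
  then obtain b where b: "\<And>x. norm (?G *v x) \<le> norm x * b" using bounded_linear.bounded by blast
  have "cmod z \<le> b" if "z \<in> complex_eigenvalues M" for z
  proof -
    from that obtain v where "v \<noteq> 0" "?G *v v = z *s v" by (auto simp: complex_eigenvalues_def)
    then have "cmod z * norm v \<le> norm v * b" using b[of v] by (simp add: norm_vector_scalar_mult)
    then show ?thesis using \<open>v \<noteq> 0\<close> by (simp add: mult.commute)
  qed
  then have "bdd_above (cmod ` complex_eigenvalues M)" by (auto simp: bdd_above_def)
  then show ?thesis unfolding spectral_radius_def by (rule cSUP_upper[OF assms])
qed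

text \<open>Embedding into complex vectors preserves norms and intertwines the orbits, so the
  complex case, where polynomials split into linear factors, applies.\<close>

lemma summable_matrix_powers:
  fixes M :: "real^'n^'n"
  assumes "spectral_radius M < 1"
  shows "summable (\<lambda>k. norm (((*v) M ^^ k) x))"
proof -
  let ?G = "map_matrix complex_of_real M" and ?c = "\<lambda>x::real^'n. (\<chi> i. complex_of_real (x $ i))"
  have "?G *v ?c y = ?c (M *v y)" for y
    by (simp add: vec_eq_iff matrix_vector_mult_def)
  then have "((*v) ?G ^^ k) (?c x) = ?c (((*v) M ^^ k) x)" for k by (induction k) auto
  moreover have "norm (?c y) = norm y" for y by (simp add: norm_vec_def)
  ultimately have "norm (((*v) M ^^ k) x) = norm (((*v) ?G ^^ k) (?c x))" for k by metis
  moreover obtain p where "p \<noteq> 0" "poly_act p ?G (?c x) = 0" by (rule annihilating_poly_exists)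
  then have "summable (\<lambda>k. norm (((*v) ?G ^^ k) (?c x)))"
    by (rule summable_matrix_powers_if_annihilated[of "complex_eigenvalues M", rotated 2])
      (use cmod_eigenvalue_le_spectral_radius[of _ M] assms in \<open>fastforce simp: complex_eigenvalues_def\<close>)+
  ultimately show ?thesis by simp
qed

section \<open>Polar sets\<close>

declare transpose_matrix_vector [simp del]

lemma closed_polar: "closed (polar S)"
proof -
  have "polar S = (\<Inter>y\<in>S. {x. y \<bullet> x \<le> 1})" by (auto simp: polar_def)
  then show ?thesis by (auto intro!: closed_INT closed_Collect_le continuous_intros)
qed

lemma convex_polar: "convex (polar S)"
proof -
  have "polar S = (\<Inter>y\<in>S. {x. y \<bullet> x \<le> 1})" by (auto simp: polar_def)
  then show ?thesis by (simp add: convex_INT convex_halfspace_le)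
qed

lemma zero_in_polar: "0 \<in> polar S"
  by (simp add: polar_def)

text \<open>A hyperplane separates a point outside \<open>S\<close> from \<open>S\<close>. Its
  offset \<open>b\<close> is negative because 0 lies in \<open>S\<close>, so a / b belongs to the
  polar and excludes the point.\<close>

lemma bipolar:
  fixes S :: "'a::euclidean_space set"
  assumes "closed S" "convex S" "0 \<in> S"
  shows "polar (polar S) = S"
proof
  show "S \<subseteq> polar (polar S)" by (auto simp: polar_def inner_commute)
  show "polar (polar S) \<subseteq> S"
  proof (rule subsetI, rule ccontr)
    fix x assume x: "x \<in> polar (polar S)" "x \<notin> S"
    from separating_hyperplane_closed_point[OF assms(2,1) x(2)]
    obtain a b where ab: "a \<bullet> x < b" "\<And>y. y \<in> S \<Longrightarrow> b < a \<bullet> y" by auto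
    then have "b < 0" using assms(3) by fastforce
    have "a /\<^sub>R b \<in> polar S"
      using ab(2) \<open>b < 0\<close> by (auto simp: polar_def inner_commute field_simps less_imp_le)
    then have "(a /\<^sub>R b) \<bullet> x \<le> 1" using x(1) unfolding polar_def by blast
    then show False using ab(1) \<open>b < 0\<close> by (simp add: field_simps)
  qed
qed

lemma bipolar_C_set: "C_set S \<Longrightarrow> polar (polar S) = S"
  by (simp add: C_set_def bipolar compact_imp_closed)

lemma polar_subset_cball:
  fixes S :: "'a::euclidean_space set"
  assumes "0 < r" "cball 0 r \<subseteq> S"
  shows "polar S \<subseteq> cball 0 (1 / r)"
proof
  fix x assume x: "x \<in> polar S"
  show "x \<in> cball 0 (1 / r)"
  proof (cases "x = 0")
    case False
    then have "(r / norm x) *\<^sub>R x \<in> S" using assms by (intro subsetD[OF assms(2)]) simp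
    then have "((r / norm x) *\<^sub>R x) \<bullet> x \<le> 1" using x by (auto simp: polar_def)
    then have "r * norm x \<le> 1" using False by (simp add: dot_square_norm power2_eq_square)
    then show ?thesis using assms by (simp add: field_simps)
  qed (use assms in simp)
qed

lemma cball_subset_polar:
  fixes S :: "'a::euclidean_space set"
  assumes "0 < R" "S \<subseteq> cball 0 R"
  shows "cball 0 (1 / R) \<subseteq> polar S"
proof
  fix x :: 'a assume x: "x \<in> cball 0 (1 / R)"
  have "y \<bullet> x \<le> 1" if "y \<in> S" for y
  proof -
    have "y \<bullet> x \<le> norm y * norm x" by (rule norm_cauchy_schwarz)
    also have "\<dots> \<le> R * (1 / R)" using that x assms by (intro mult_mono) auto
    finally show ?thesis using assms by simp
  qed
  then show "x \<in> polar S" by (simp add: polar_def)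
qed

lemma C_set_subset_cball:
  assumes "C_set S"
  obtains R where "0 < R" "S \<subseteq> cball 0 R"
  using assms bounded_subset_ballD[of S 0] compact_imp_bounded ball_subset_cball
  unfolding C_set_def by (metis subset_trans)

lemma proper_C_set_iff: "proper_C_set S \<longleftrightarrow> C_set S \<and> (\<exists>r>0. cball 0 r \<subseteq> S)"
  by (simp add: proper_C_set_def mem_interior_cball)

lemma C_set_polar:
  assumes "0 < r" "cball 0 r \<subseteq> S"
  shows "C_set (polar S)"
  using polar_subset_cball[OF assms] bounded_subset[OF bounded_cball]
  by (auto simp: C_set_def compact_eq_bounded_closed closed_polar convex_polar zero_in_polar)

lemma proper_C_set_polar:
  assumes "proper_C_set S"
  shows "proper_C_set (polar S)"
  using assms cball_subset_polar C_set_polar C_set_subset_cball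
  unfolding proper_C_set_iff by (metis zero_less_divide_1_iff)

section \<open>The dynamics on polar sets\<close>

text \<open>The slice at zero second component reflects that the polar of a projection is a slice of
  the polar. \<open>D\<close> stands for the polar of \<open>C\<close>.\<close>

definition polar_step ::
    "real^'n^'n \<Rightarrow> real^'m^'n \<Rightarrow> ((real^'n) \<times> (real^'m)) set \<Rightarrow> (real^'n) set \<Rightarrow> (real^'n) set" where
  "polar_step A B D Q = {y. (y, 0) \<in> D + block_transpose A B ` Q}"

lemma polar_step_iff:
  "y \<in> polar_step A B D Q \<longleftrightarrow>
    (\<exists>c d q. (c, d) \<in> D \<and> q \<in> Q \<and> y = c + transpose A *v q \<and> d + transpose B *v q = 0)"
proof
  assume "y \<in> polar_step A B D Q"
  then obtain p q where "p \<in> D" "q \<in> Q" "(y, 0) = p + block_transpose A B q"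
    by (auto simp: polar_step_def elim!: set_plus_elim)
  then show "\<exists>c d q. (c, d) \<in> D \<and> q \<in> Q \<and> y = c + transpose A *v q \<and> d + transpose B *v q = 0"
    by (intro exI[of _ "fst p"] exI[of _ "snd p"] exI[of _ q]) (simp add: prod_eq_iff block_transpose_def)
next
  assume "\<exists>c d q. (c, d) \<in> D \<and> q \<in> Q \<and> y = c + transpose A *v q \<and> d + transpose B *v q = 0"
  then obtain c d q where "(c, d) \<in> D" "q \<in> Q" "(y, 0) = (c, d) + block_transpose A B q"
    by (auto simp: block_transpose_def)
  then show "y \<in> polar_step A B D Q"
    by (simp add: polar_step_def set_plus_intro)
qed

lemma polar_stepI:
  "(c, d) \<in> D \<Longrightarrow> q \<in> Q \<Longrightarrow> y = c + transpose A *v q \<Longrightarrow> d + transpose B *v q = 0 \<Longrightarrow>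
    y \<in> polar_step A B D Q"
  unfolding polar_step_iff by blast

lemma polar_step_mono: "Q \<subseteq> Q' \<Longrightarrow> polar_step A B D Q \<subseteq> polar_step A B D Q'"
  unfolding polar_step_def by (intro Collect_mono impI) (meson image_mono set_plus_mono2 subsetD subset_refl)

lemma linear_block_transpose: "linear (block_transpose A B)"
  unfolding block_transpose_def
  by (intro linearI) (simp_all add: matrix_vector_right_distrib matrix_vector_mult_scaleR)

lemma C_set_plus_image:
  assumes "C_set D" "C_set Q" "linear f"
  shows "C_set (D + f ` Q)"
proof -
  have "compact (f ` Q)"
    using assms by (intro compact_continuous_image linear_continuous_on)
      (auto simp: C_set_def linear_conv_bounded_linear)
  moreover have "D + f ` Q = {x + y |x y. x \<in> D \<and> y \<in> f ` Q}"
    by (auto simp: set_plus_def)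
  ultimately have "compact (D + f ` Q)"
    using assms(1) compact_sums[of D "f ` Q"] by (simp only: C_set_def)
  moreover have "convex (D + f ` Q)"
    using assms convex_linear_image[of f Q] by (simp only: C_set_def convex_set_plus)
  moreover have "0 + f 0 \<in> D + f ` Q"
    using assms by (intro set_plus_intro imageI) (simp_all only: C_set_def)
  ultimately show ?thesis using linear_0[OF assms(3)] by (simp only: C_set_def add_0)
qed

lemma cball_subset_plus:
  assumes "cball 0 r \<subseteq> D" "(0::'a::euclidean_space) \<in> S"
  shows "cball 0 r \<subseteq> D + S"
  using assms set_plus_intro[of _ D 0 S] by fastforce

lemma C_set_polar_step:
  assumes "C_set D" "C_set Q"
  shows "C_set (polar_step A B D Q)"
proof -
  let ?S = "D + block_transpose A B ` Q"
  have S: "C_set ?S" by (intro C_set_plus_image assms linear_block_transpose)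
  have "polar_step A B D Q = fst ` (?S \<inter> UNIV \<times> {0})"
    by (simp add: polar_step_def set_eq_iff image_iff Bex_def)
  moreover have "compact (?S \<inter> UNIV \<times> {0})"
    using S by (intro compact_Int_closed closed_Times) (auto simp: C_set_def)
  moreover have "convex (?S \<inter> UNIV \<times> {0})"
    using S by (intro convex_Int convex_Times) (auto simp: C_set_def)
  moreover have "(0, 0) \<in> ?S" using S by (simp add: C_set_def zero_prod_def)
  ultimately show ?thesis
    unfolding C_set_def
    by (auto intro!: compact_continuous_image continuous_intros convex_linear_image linear_fst image_eqI[of _ _ "(0, 0)"])
qed

lemma polar_fst_image:
  fixes S :: "('a::euclidean_space \<times> 'b::euclidean_space) set"
  shows "polar (fst ` S) = {y. (y, 0) \<in> polar S}"
  by (auto simp: polar_def inner_prod_def)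

text \<open>The Minkowski sum contains a ball, so its polar and the projection of that polar are
  C-sets. The bipolar theorem recovers the projection from its own polar, which is the slice of the
  sum.\<close>

lemma set_dynamics_polar:
  fixes A :: "real^'n^'n" and B :: "real^'m^'n"
  assumes "proper_C_set C" "C_set Q"
  shows "set_dynamics A B C (polar Q) = polar (polar_step A B (polar C) Q)"
proof -
  let ?S = "polar C + block_transpose A B ` Q"
  have D: "proper_C_set (polar C)" using assms(1) by (rule proper_C_set_polar)
  then have S: "C_set ?S"
    using assms(2) by (intro C_set_plus_image linear_block_transpose) (auto simp: proper_C_set_def)
  obtain r where "0 < r" "cball 0 r \<subseteq> polar C" using D by (auto simp: proper_C_set_iff)
  moreover have "(0::(real^'n) \<times> (real^'m)) \<in> block_transpose A B ` Q"
    using assms(2) linear_0[OF linear_block_transpose[of A B]] by (force simp: C_set_def)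
  ultimately have "cball 0 r \<subseteq> ?S" by (intro cball_subset_plus)
  then have pS: "C_set (polar ?S)" using \<open>0 < r\<close> by (intro C_set_polar)
  then have "C_set (fst ` polar ?S)"
    unfolding C_set_def by (auto intro!: compact_continuous_image continuous_intros convex_linear_image linear_fst
        image_eqI[of _ _ "(0, 0)"] simp: zero_prod_def[symmetric])
  then have "fst ` polar ?S = polar (polar (fst ` polar ?S))" by (simp add: bipolar_C_set)
  also have "\<dots> = polar {y. (y, 0) \<in> ?S}" by (simp add: polar_fst_image bipolar_C_set S)
  finally show ?thesis
    by (simp add: set_dynamics_def polar_step_def bipolar_C_set assms(2))
qed

lemma set_dynamics_iterate:
  assumes "proper_C_set C" "C_set Q"
  shows "(set_dynamics A B C ^^ k) (polar Q) = polar ((polar_step A B (polar C) ^^ k) Q)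
    \<and> C_set ((polar_step A B (polar C) ^^ k) Q)"
proof (induction k)
  case (Suc k)
  have "C_set (polar C)" using proper_C_set_polar[OF assms(1)] by (simp add: proper_C_set_def)
  then show ?case using Suc assms by (simp add: set_dynamics_polar C_set_polar_step)
qed (use assms in simp)

text \<open>The choice q = 0 already gives the slice of \<open>D\<close>. Hence the polar of any
  step is bounded, which makes the iterates compact from index 1 on even for an unbounded initial
  set.\<close>

lemma polar_step_contains_cball:
  assumes "cball 0 r \<subseteq> D" "0 \<in> Q"
  shows "cball 0 r \<subseteq> polar_step A B D Q"
proof
  fix y :: "real^'a" assume "y \<in> cball 0 r"
  then have "(y, 0) \<in> D" by (intro subsetD[OF assms(1)]) (simp add: norm_Pair)
  then show "y \<in> polar_step A B D Q" using assms(2) by (intro polar_stepI[of y 0 D 0]) auto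
qed

section \<open>Existence of a fixed point\<close>

lemma inner_transpose_matrix: "(transpose A *v x) \<bullet> y = x \<bullet> (A *v y)"
  for A :: "real^'n^'m"
  by (simp add: transpose_matrix_vector dot_lmul_matrix)

text \<open>On an iterate of \<open>{0}\<close>, the value of \<open>x\<close> is at most the cost of steering \<open>x\<close> by the feedback \<open>K\<close>.\<close>

lemma polar_step_iterates_bounded:
  fixes A :: "real^'n^'n" and B :: "real^'m^'n"
  assumes "strictly_stabilizable A B" "bounded D"
  obtains M where "\<And>k. (polar_step A B D ^^ k) {0} \<subseteq> cball 0 M"
proof -
  obtain K where K: "spectral_radius (A + B ** K) < 1"
    using assms(1) by (auto simp: strictly_stabilizable_def)
  define F where "F = A + B ** K"
  define s where "s x = (\<Sum>j. norm (((*v) F ^^ j) x))" for x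
  have sum: "summable (\<lambda>j. norm (((*v) F ^^ j) x))" for x
    using K by (simp add: F_def summable_matrix_powers)
  have "bounded ((\<lambda>(c, d). c + transpose K *v d) ` D)"
    by (intro bounded_linear_image[OF assms(2)])
      (auto simp: linear_conv_bounded_linear[symmetric] matrix_vector_right_distrib
        matrix_vector_mult_scaleR algebra_simps intro!: linearI)
  then obtain R where "R > 0" and R: "\<And>c d. (c, d) \<in> D \<Longrightarrow> norm (c + transpose K *v d) \<le> R"
    unfolding bounded_pos by fastforce
  have value_le: "q \<bullet> x \<le> R * (\<Sum>j<k. norm (((*v) F ^^ j) x))"
    if "q \<in> (polar_step A B D ^^ k) {0}" for q x k
    using that
  proof (induction k arbitrary: q x)
    case (Suc k)
    then obtain c d p where cdp: "(c, d) \<in> D" "p \<in> (polar_step A B D ^^ k) {0}"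
      "q = c + transpose A *v p" "d + transpose B *v p = 0"
      by (auto simp: polar_step_iff)
    \<comment> \<open>Pairing the constraint with the feedback input \<open>K *v x\<close> gives a
      zero that, added to q \<bullet> x, replaces \<open>A\<close> by the closed loop
      \<open>F\<close> and c by c + K^T d.\<close>
    have "0 = (d + transpose B *v p) \<bullet> (K *v x)" using cdp(4) by simp
    also have "\<dots> = (transpose K *v d) \<bullet> x + p \<bullet> ((B ** K) *v x)"
      by (simp add: inner_add_left inner_transpose_matrix matrix_vector_mul_assoc)
    finally have "q \<bullet> x = (c + transpose K *v d) \<bullet> x + p \<bullet> (F *v x)"
      by (simp add: cdp(3) F_def inner_add_left inner_add_right inner_transpose_matrix
        matrix_vector_mult_add_rdistrib)
    also have "(c + transpose K *v d) \<bullet> x \<le> R * norm x"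
      using norm_cauchy_schwarz[of "c + transpose K *v d" x] R[OF cdp(1)]
      by (meson mult_right_mono norm_ge_zero order_trans)
    also have "p \<bullet> (F *v x) \<le> R * (\<Sum>j<k. norm (((*v) F ^^ j) (F *v x)))"
      using Suc.IH cdp(2) .
    finally show ?case
      by (simp add: sum.lessThan_Suc_shift funpow_swap1 algebra_simps del: sum.lessThan_Suc)
  qed simp
  have value_le': "q \<bullet> x \<le> R * s x" if "q \<in> (polar_step A B D ^^ k) {0}" for q x k
  proof -
    have "(\<Sum>j<k. norm (((*v) F ^^ j) x)) \<le> s x"
      unfolding s_def by (intro sum_le_suminf sum) auto
    then show ?thesis using value_le[OF that, of x] \<open>R > 0\<close> by (meson mult_left_mono order_trans less_imp_le)
  qed
  \<comment> \<open>The bound on q \<bullet> x is one-sided, so every coordinate is tested with b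
    and with - b. The resulting bound does not depend on \<open>k\<close>.\<close>
  have "norm q \<le> (\<Sum>b\<in>Basis. \<bar>R * s b\<bar> + \<bar>R * s (-b)\<bar>)" if "q \<in> (polar_step A B D ^^ k) {0}" for q k
  proof -
    have "\<bar>q \<bullet> b\<bar> \<le> \<bar>R * s b\<bar> + \<bar>R * s (-b)\<bar>" for b
      using value_le'[OF that, of b] value_le'[OF that, of "-b"] by simp
    then show ?thesis using norm_le_l1[of q] by (meson order_trans sum_mono)
  qed
  then show ?thesis by (intro that) auto
qed

text \<open>The relations between y, c, d and q are linear, and \<open>D\<close> is star-shaped
  about 0, so a whole representation of y can be scaled by t.\<close>

lemma polar_step_scale_subset:
  assumes "C_set D" "0 \<le> t" "t \<le> 1" "y \<in> polar_step A B D Q" "\<And>q. q \<in> Q \<Longrightarrow> t *\<^sub>R q \<in> Q'"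
  shows "t *\<^sub>R y \<in> polar_step A B D Q'"
proof -
  obtain c d q where y: "(c, d) \<in> D" "q \<in> Q" "y = c + transpose A *v q" "d + transpose B *v q = 0"
    using assms(4) by (auto simp: polar_step_iff)
  have "t *\<^sub>R (c, d) + (1 - t) *\<^sub>R 0 \<in> D"
    using assms(1-3) y(1) unfolding C_set_def by (intro convexD) auto
  then have "(t *\<^sub>R c, t *\<^sub>R d) \<in> D" by simp
  moreover have "t *\<^sub>R d + transpose B *v (t *\<^sub>R q) = 0"
    using y(4) by (metis matrix_vector_mult_scaleR scaleR_right_distrib scaleR_zero_right)
  ultimately show ?thesis
    using y assms(5) by (intro polar_stepI[of "t *\<^sub>R c" "t *\<^sub>R d" D "t *\<^sub>R q"])
      (auto simp: scaleR_right_distrib matrix_vector_mult_scaleR)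
qed

lemma polar_step_fixed_point_exists:
  fixes A :: "real^'n^'n" and B :: "real^'m^'n"
  assumes "strictly_stabilizable A B" "proper_C_set D"
  obtains Q where "proper_C_set Q" "polar_step A B D Q = Q"
proof -
  let ?T = "polar_step A B D"
  define S where "S k = (?T ^^ k) {0}" for k
  define U where "U = (\<Union>k. S k)"
  have D: "C_set D" using assms(2) by (simp add: proper_C_set_def)
  have C: "C_set (S k)" for k
    by (induction k) (simp_all add: S_def C_set_polar_step D, simp add: C_set_def)
  have Suc: "S (Suc k) = ?T (S k)" for k by (simp add: S_def)
  have "S k \<subseteq> S (Suc k)" for k
  proof (induction k)
    case 0
    show ?case using C[of "Suc 0"] by (simp add: S_def C_set_def)
  next
    case (Suc k)
    then show ?case unfolding \<open>\<And>k. S (Suc k) = ?T (S k)\<close> by (rule polar_step_mono)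
  qed
  then have inc: "i \<le> j \<Longrightarrow> S i \<subseteq> S j" for i j by (rule lift_Suc_mono_le)
  have "convex U"
  proof (rule convexI)
    fix x y :: "real^'n" and u v :: real
    assume *: "x \<in> U" "y \<in> U" "0 \<le> u" "0 \<le> v" "u + v = 1"
    then obtain i j where "x \<in> S i" "y \<in> S j" by (auto simp: U_def)
    then have "x \<in> S (max i j)" "y \<in> S (max i j)" using inc[of i "max i j"] inc[of j "max i j"] by auto
    then have "u *\<^sub>R x + v *\<^sub>R y \<in> S (max i j)" using C * by (intro convexD) (auto simp: C_set_def)
    then show "u *\<^sub>R x + v *\<^sub>R y \<in> U" by (auto simp: U_def)
  qed
  obtain r where r: "0 < r" "cball 0 r \<subseteq> D" using assms(2) by (auto simp: proper_C_set_iff)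
  have "cball 0 r \<subseteq> S (Suc 0)" using polar_step_contains_cball[OF r(2), of "{0}"] by (simp add: S_def)
  then have rU: "cball 0 r \<subseteq> U" by (auto simp: U_def)
  have "bounded D" using D by (simp add: C_set_def compact_imp_bounded)
  then obtain M where "\<And>k. S k \<subseteq> cball 0 M"
    using polar_step_iterates_bounded[OF assms(1)] unfolding S_def by metis
  then have "bounded U" by (intro bounded_subset[OF bounded_cball, of U 0 M]) (auto simp: U_def)
  define Q where "Q = closure U"
  have rQ: "cball 0 r \<subseteq> Q" using rU closure_subset by (auto simp: Q_def)
  then have CQ: "C_set Q"
    using \<open>convex U\<close> \<open>bounded U\<close> r(1) by (auto simp: C_set_def Q_def convex_closure)
  have TQ: "closed (?T Q)" using C_set_polar_step[OF D CQ] by (simp add: C_set_def compact_imp_closed)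
  have "S k \<subseteq> ?T Q" for k
  proof (cases k)
    case 0
    then show ?thesis using C_set_polar_step[OF D CQ] by (simp add: S_def C_set_def)
  next
    case (Suc j)
    have "S j \<subseteq> Q" using closure_subset[of U] by (auto simp: Q_def U_def)
    then show ?thesis unfolding Suc \<open>\<And>k. S (Suc k) = ?T (S k)\<close> by (rule polar_step_mono)
  qed
  then have "Q \<subseteq> ?T Q" unfolding Q_def by (intro closure_minimal TQ[unfolded Q_def]) (auto simp: U_def)
  moreover have "?T Q \<subseteq> Q"
  proof
    fix y assume y: "y \<in> ?T Q"
    have scaled: "t *\<^sub>R y \<in> Q" if "0 < t" "t < 1" for t
    proof -
      obtain c d q where cdq: "(c, d) \<in> D" "q \<in> Q" "y = c + transpose A *v q" "d + transpose B *v q = 0"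
        using y by (auto simp: polar_step_iff)
      have "0 \<in> interior U" using rU r(1) by (auto simp: mem_interior_cball)
      from mem_interior_closure_convex_shrink[OF \<open>convex U\<close> this, of q "1 - t"]
      have "t *\<^sub>R q \<in> U" using cdq(2) that interior_subset by (auto simp: Q_def algebra_simps)
      then obtain k where k: "t *\<^sub>R q \<in> S k" by (auto simp: U_def)
      have "y \<in> ?T {q}" using cdq by (intro polar_stepI) auto
      then have "t *\<^sub>R y \<in> ?T (S k)" using that k by (intro polar_step_scale_subset[OF D]) auto
      then have "t *\<^sub>R y \<in> S (Suc k)" by (simp add: S_def)
      then show ?thesis using closure_subset[of U] by (auto simp: Q_def U_def)
    qed
    have "((\<lambda>t. t *\<^sub>R y) \<longlongrightarrow> 1 *\<^sub>R y) (at_left (1::real))" by (intro tendsto_intros)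
    moreover have "\<forall>\<^sub>F t in at_left (1::real). t *\<^sub>R y \<in> Q"
      by (rule eventually_at_leftI[of 0]) (use scaled in auto)
    moreover have "closed Q" by (simp add: Q_def)
    ultimately have "1 *\<^sub>R y \<in> Q"
      by (intro Lim_in_closed_set[of Q "\<lambda>t. t *\<^sub>R y" "at_left (1::real)"]) auto
    then show "y \<in> Q" by simp
  qed
  ultimately show ?thesis
    using CQ rQ r(1) by (intro that[of Q]) (auto simp: proper_C_set_iff)
qed

section \<open>Contraction towards a fixed point\<close>

definition radially_close :: "real \<Rightarrow> real \<Rightarrow> 'a::real_vector set \<Rightarrow> 'a set \<Rightarrow> bool" where
  "radially_close a b Q P \<longleftrightarrow> Q \<subseteq> (*\<^sub>R) (1 + a) ` P \<and> (*\<^sub>R) (1 - b) ` P \<subseteq> Q"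

text \<open>Cancellation: \<open>z / (1 - s)\<close> is the limit of the iterates of \<open>w \<mapsto> z + s w\<close> started at \<open>0\<close>.\<close>

lemma cancel_scaled_set:
  fixes Q :: "'a::real_normed_vector set"
  assumes "closed Q" "0 \<in> Q" "0 \<le> s" "s < 1" "\<And>w. w \<in> Q \<Longrightarrow> z + s *\<^sub>R w \<in> Q"
  shows "z /\<^sub>R (1 - s) \<in> Q"
proof -
  define w where "w k = ((1 - s ^ k) / (1 - s)) *\<^sub>R z" for k
  have "w k \<in> Q" for k
  proof (induction k)
    case (Suc k)
    have "(1 - s ^ Suc k) / (1 - s) = 1 + s * ((1 - s ^ k) / (1 - s))"
      using assms(4) by (simp add: field_simps)
    then have "w (Suc k) = z + s *\<^sub>R w k" by (simp add: w_def scaleR_left_distrib del: power_Suc)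
    then show ?case using Suc assms(5) by simp
  qed (use assms(2) in \<open>simp add: w_def\<close>)
  moreover have "w \<longlonglongrightarrow> ((1 - 0) / (1 - s)) *\<^sub>R z"
    unfolding w_def using assms(3,4) by (intro tendsto_intros LIMSEQ_realpow_zero) auto
  ultimately show ?thesis
    using closed_sequentially[OF assms(1), of w] by (metis diff_zero inverse_eq_divide)
qed

lemma polar_step_contraction:
  assumes D: "convex D" "0 \<in> D" and Q: "C_set Q" "polar_step A B D Q = Q"
    and m: "0 < m" "m < 1" "\<And>w. w \<in> Q \<Longrightarrow> (m *\<^sub>R w, 0) \<in> D"
    and ab: "0 \<le> a" "0 \<le> b" "b \<le> 1" and close: "radially_close a b Q' Q"
  shows "radially_close ((1 - m) * a) ((1 - m) * b) (polar_step A B D Q') Q"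
  unfolding radially_close_def
proof (intro conjI subsetI)
  fix y assume "y \<in> polar_step A B D Q'"
  then obtain c d q where y: "(c, d) \<in> D" "q \<in> Q'" "y = c + transpose A *v q" "d + transpose B *v q = 0"
    by (auto simp: polar_step_iff)
  then obtain p where p: "p \<in> Q" "q = (1 + a) *\<^sub>R p" using close by (auto simp: radially_close_def)
  let ?z = "y /\<^sub>R (1 + a)" and ?s = "m * a / (1 + a)"
  have s: "0 \<le> ?s" "?s < 1"
    using m ab(1) mult_left_le_one_le[of a m] by (auto simp: divide_less_eq intro: order_le_less_trans)
  have "?z + ?s *\<^sub>R w \<in> Q" if "w \<in> Q" for w
  proof -
    have "(1 / (1 + a)) *\<^sub>R (c, d) + (a / (1 + a)) *\<^sub>R (m *\<^sub>R w, 0) \<in> D"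
      using D y(1) m(3)[OF that] ab(1) by (intro convexD) (auto simp: field_simps)
    then have "(c /\<^sub>R (1 + a) + ?s *\<^sub>R w, d /\<^sub>R (1 + a)) \<in> D"
      by (simp add: divide_inverse ac_simps)
    moreover have "d /\<^sub>R (1 + a) + transpose B *v p = (d + transpose B *v q) /\<^sub>R (1 + a)"
      using ab(1) by (simp add: p(2) scaleR_right_distrib matrix_vector_mult_scaleR)
    then have "d /\<^sub>R (1 + a) + transpose B *v p = 0" by (simp add: y(4))
    moreover have "?z + ?s *\<^sub>R w = c /\<^sub>R (1 + a) + ?s *\<^sub>R w + transpose A *v p"
      using ab(1) by (simp add: y(3) p(2) scaleR_right_distrib matrix_vector_mult_scaleR)
    ultimately have "?z + ?s *\<^sub>R w \<in> polar_step A B D Q" using p(1) by (intro polar_stepI)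
    then show ?thesis by (simp add: Q(2))
  qed
  then have "?z /\<^sub>R (1 - ?s) \<in> Q"
    using Q(1) s by (intro cancel_scaled_set) (auto simp: C_set_def compact_imp_closed)
  moreover have "y = (1 + (1 - m) * a) *\<^sub>R (?z /\<^sub>R (1 - ?s))"
  proof -
    have cancel: "u * v * (inverse v * inverse u) = 1" if "u \<noteq> 0" "v \<noteq> 0" for u v :: real
      using that by (simp add: field_simps)
    have "1 + (1 - m) * a = (1 + a) * (1 - ?s)" using ab(1) by (simp add: field_simps)
    then have "(1 + (1 - m) * a) *\<^sub>R (?z /\<^sub>R (1 - ?s))
        = ((1 + a) * (1 - ?s) * (inverse (1 - ?s) * inverse (1 + a))) *\<^sub>R y"
      by (simp only: scaleR_scaleR mult.assoc)
    also have "\<dots> = y"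
      using s(2) ab(1) by (subst cancel) auto
    finally show ?thesis by simp
  qed
  ultimately show "y \<in> (*\<^sub>R) (1 + (1 - m) * a) ` Q" by blast
next
  fix x assume "x \<in> (*\<^sub>R) (1 - (1 - m) * b) ` Q"
  then obtain y where y: "y \<in> Q" "x = (1 - (1 - m) * b) *\<^sub>R y" by blast
  then obtain c d q where q: "(c, d) \<in> D" "q \<in> Q" "y = c + transpose A *v q" "d + transpose B *v q = 0"
    using Q(2) by (metis polar_step_iff)
  have "(1 - b) *\<^sub>R (c, d) + b *\<^sub>R (m *\<^sub>R y, 0) \<in> D"
    using D q(1) m(3)[OF y(1)] ab by (intro convexD) auto
  then have "((1 - b) *\<^sub>R c + (b * m) *\<^sub>R y, (1 - b) *\<^sub>R d) \<in> D" by simp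
  moreover have "(1 - b) *\<^sub>R q \<in> Q'" using close q(2) by (auto simp: radially_close_def)
  moreover have "x = (1 - b) *\<^sub>R y + (b * m) *\<^sub>R y"
    unfolding y(2) scaleR_left_distrib[symmetric] by (simp add: algebra_simps)
  then have "x = (1 - b) *\<^sub>R c + (b * m) *\<^sub>R y + transpose A *v ((1 - b) *\<^sub>R q)"
    by (subst (asm) (1) q(3)) (simp add: scaleR_right_distrib matrix_vector_mult_scaleR algebra_simps)
  moreover have "(1 - b) *\<^sub>R d + transpose B *v ((1 - b) *\<^sub>R q) = 0"
    using q(4) by (simp add: matrix_vector_mult_scaleR flip: scaleR_right_distrib)
  ultimately show "x \<in> polar_step A B D Q'" by (rule polar_stepI)
qed

lemma polar_step_iterates_close:
  assumes D: "proper_C_set D" and Q: "C_set Q" "polar_step A B D Q = Q"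
  obtains l where "0 < l" "l < 1"
    "\<And>k a b Q'. 0 \<le> a \<Longrightarrow> 0 \<le> b \<Longrightarrow> b \<le> 1 \<Longrightarrow> radially_close a b Q' Q \<Longrightarrow>
       radially_close (l ^ k * a) (l ^ k * b) ((polar_step A B D ^^ k) Q') Q"
proof -
  obtain r where r: "0 < r" "cball 0 r \<subseteq> D" using D by (auto simp: proper_C_set_iff)
  obtain R where R: "0 < R" "Q \<subseteq> cball 0 R" using C_set_subset_cball[OF Q(1)] .
  define m where "m = min (1 / 2) (r / R)"
  have m: "0 < m" "m < 1" using r R by (auto simp: m_def)
  have mD: "(m *\<^sub>R w, 0) \<in> D" if "w \<in> Q" for w
  proof -
    have "m * norm w \<le> r / R * R"
      using R that r(1) by (intro mult_mono) (auto simp: m_def)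
    then show ?thesis using m(1) R(1) by (intro subsetD[OF r(2)]) (simp add: norm_Pair)
  qed
  have CD: "convex D" "0 \<in> D" using D by (auto simp: proper_C_set_def C_set_def)
  show ?thesis
  proof (rule that[of "1 - m"])
    fix k and a b :: real and Q'
    assume *: "0 \<le> a" "0 \<le> b" "b \<le> 1" "radially_close a b Q' Q"
    show "radially_close ((1 - m) ^ k * a) ((1 - m) ^ k * b) ((polar_step A B D ^^ k) Q') Q"
    proof (induction k)
      case (Suc k)
      have "(1 - m) ^ k * b \<le> 1" using m * by (intro mult_le_one power_le_one) auto
      from polar_step_contraction[OF CD Q m mD _ _ this Suc] show ?case
        using m * by (simp add: mult.assoc)
    qed (use * in simp)
  qed (use m in auto)
qed

lemma hausdorff_dist_attained:
  fixes S T :: "'a::euclidean_space set"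
  assumes "compact S" "compact T" "T \<noteq> {}" "x \<in> S"
  obtains y where "y \<in> T" "dist x y \<le> hausdorff_dist S T"
proof -
  obtain y where y: "y \<in> T" "infdist x T = dist x y"
    using infdist_attains_inf[of T x] assms by (auto simp: compact_imp_closed)
  have "bdd_above ((\<lambda>x. infdist x T) ` S)"
    by (intro bounded_imp_bdd_above compact_imp_bounded compact_continuous_image
        continuous_on_infdist continuous_on_id assms)
  then have "infdist x T \<le> (SUP x\<in>S. infdist x T)" using assms(4) by (intro cSUP_upper)
  then show ?thesis using y by (intro that) (auto simp: hausdorff_dist_def)
qed

lemma hausdorff_dist_commute: "hausdorff_dist S T = hausdorff_dist T S"
  by (simp add: hausdorff_dist_def max.commute)

lemma hausdorff_dist_nonneg:
  fixes S T :: "'a::euclidean_space set"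
  assumes "C_set S" "C_set T"
  shows "0 \<le> hausdorff_dist S T"
  using assms hausdorff_dist_attained[of S T 0]
  by (metis C_set_def dist_self dual_order.trans empty_iff zero_le_dist)

lemma hausdorff_dist_zero_subset:
  fixes S T :: "'a::euclidean_space set"
  assumes "C_set S" "C_set T" "hausdorff_dist S T = 0"
  shows "S \<subseteq> T"
proof
  fix x assume "x \<in> S"
  then obtain y where "y \<in> T" "dist x y \<le> 0"
    using hausdorff_dist_attained[of S T x] assms by (metis C_set_def empty_iff)
  then show "x \<in> T" by simp
qed

lemma hausdorff_dist_polar_le:
  fixes Q P :: "'a::euclidean_space set"
  assumes "radially_close a b Q P" "0 \<le> a" "0 \<le> b" "b \<le> 1 / 2" "polar P \<subseteq> cball 0 R"
  shows "hausdorff_dist (polar Q) (polar P) \<le> (a + 2 * b) * R"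
proof -
  have "0 \<in> cball (0::'a) R" using assms(5) zero_in_polar by blast
  then have "0 \<le> R" by simp
  have "infdist x (polar P) \<le> (a + 2 * b) * R" if x: "x \<in> polar Q" for x
  proof -
    have "(1 - b) *\<^sub>R x \<in> polar P"
      using x assms(1) by (fastforce simp: polar_def radially_close_def)
    then have "norm ((1 - b) *\<^sub>R x) \<le> R" using assms(5) by auto
    then have "(1 - b) * norm x \<le> R" using assms(4) by simp
    moreover have "1 / 2 * norm x \<le> (1 - b) * norm x" using assms(4) by (intro mult_right_mono) auto
    ultimately have "norm x \<le> 2 * R" by simp
    then have "b * norm x \<le> b * (2 * R)" using assms(3) by (intro mult_left_mono)
    also have "\<dots> \<le> (a + 2 * b) * R" using assms \<open>0 \<le> R\<close> by (simp add: algebra_simps)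
    finally have "dist x ((1 - b) *\<^sub>R x) \<le> (a + 2 * b) * R"
      using assms(3) by (simp add: dist_norm algebra_simps)
    then show ?thesis by (rule infdist_le2[OF \<open>(1 - b) *\<^sub>R x \<in> polar P\<close>])
  qed
  moreover have "infdist y (polar Q) \<le> (a + 2 * b) * R" if y: "y \<in> polar P" for y
  proof -
    have mem: "y /\<^sub>R (1 + a) \<in> polar Q"
      unfolding polar_def
    proof safe
      fix q assume "q \<in> Q"
      then obtain p where p: "p \<in> P" "q = (1 + a) *\<^sub>R p" using assms(1) by (auto simp: radially_close_def)
      have "q \<bullet> (y /\<^sub>R (1 + a)) = p \<bullet> y" using assms(2) by (simp add: p(2) inner_add_left field_simps)
      then show "q \<bullet> (y /\<^sub>R (1 + a)) \<le> 1" using y p(1) by (simp add: polar_def)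
    qed
    have "1 - inverse (1 + a) = a * inverse (1 + a)" using assms(2) by (simp add: field_simps)
    moreover have "y - y /\<^sub>R (1 + a) = (1 - inverse (1 + a)) *\<^sub>R y" by (simp add: algebra_simps)
    ultimately have "dist y (y /\<^sub>R (1 + a)) = (a * inverse (1 + a)) * norm y"
      using assms(2) by (simp add: dist_norm)
    also have "\<dots> \<le> (a * 1) * R"
      using assms y \<open>0 \<le> R\<close> by (intro mult_mono) (auto simp: inverse_le_1_iff)
    also have "\<dots> \<le> (a + 2 * b) * R" using assms \<open>0 \<le> R\<close> by (simp add: algebra_simps)
    finally show ?thesis by (rule infdist_le2[OF mem])
  qed
  ultimately show ?thesis
    unfolding hausdorff_dist_def by (auto intro!: cSUP_least) (use zero_in_polar in blast)+
qed

lemma radially_close_polar: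
  fixes S T :: "'a::euclidean_space set"
  assumes S: "C_set S" and T: "C_set T" and r: "0 < r" "cball 0 r \<subseteq> T"
    and s: "0 \<le> s" "s \<le> 1 / 2" "hausdorff_dist S T \<le> s * r"
  shows "radially_close (s / (1 - s)) (s / (1 - s)) (polar S) (polar T)"
proof -
  have compact: "compact S" "compact T" "S \<noteq> {}" "T \<noteq> {}" using S T by (auto simp: C_set_def)
  have direction: "\<exists>x\<in>T. x \<bullet> q = r * norm q" for q
    by (rule bexI[of _ "(r / norm q) *\<^sub>R q"])
      (use r in \<open>auto simp: dot_square_norm power2_eq_square intro!: subsetD[OF r(2)]\<close>)
  have near: "x \<bullet> q \<le> y \<bullet> q + s * (r * norm q)" if "dist x y \<le> s * r" for x y q :: 'a
  proof -
    have "(x - y) \<bullet> q \<le> norm (x - y) * norm q" by (rule norm_cauchy_schwarz)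
    also have "\<dots> \<le> (s * r) * norm q" using that by (intro mult_right_mono) (auto simp: dist_norm)
    finally show ?thesis by (simp add: algebra_simps)
  qed
  have "q \<in> (*\<^sub>R) (1 + s / (1 - s)) ` polar T" if q: "q \<in> polar S" for q
  proof -
    obtain x where x: "x \<in> T" "\<And>y. y \<in> T \<Longrightarrow> y \<bullet> q \<le> x \<bullet> q"
      using continuous_attains_sup[OF compact(2,4), of "\<lambda>x. x \<bullet> q"] continuous_on_inner[OF continuous_on_id continuous_on_const]
      by blast
    obtain y where y: "y \<in> S" "dist x y \<le> hausdorff_dist T S"
      using hausdorff_dist_attained[OF compact(2,1,3) x(1)] .
    have "x \<bullet> q \<le> y \<bullet> q + s * (r * norm q)"
      using y s(3) by (intro near) (simp add: hausdorff_dist_commute)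
    also have "r * norm q \<le> x \<bullet> q" using x(2) direction[of q] by metis
    then have "y \<bullet> q + s * (r * norm q) \<le> 1 + s * (x \<bullet> q)"
      using q y(1) s(1) by (intro add_mono mult_left_mono) (auto simp: polar_def)
    finally have "(1 - s) * (x \<bullet> q) \<le> 1" by (simp add: algebra_simps)
    moreover have "(1 - s) * (v \<bullet> q) \<le> (1 - s) * (x \<bullet> q)" if "v \<in> T" for v
      using x(2)[OF that] s(2) by (intro mult_left_mono) auto
    ultimately have "(1 - s) *\<^sub>R q \<in> polar T" by (fastforce simp: polar_def)
    moreover have "(1 + s / (1 - s)) * (1 - s) = 1" using s(2) by (simp add: field_simps)
    then have "q = (1 + s / (1 - s)) *\<^sub>R ((1 - s) *\<^sub>R q)" by (simp only: scaleR_scaleR scaleR_one)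
    ultimately show ?thesis by blast
  qed
  moreover have "(1 - s / (1 - s)) *\<^sub>R p \<in> polar S" if p: "p \<in> polar T" for p
    unfolding polar_def
  proof safe
    fix x assume "x \<in> S"
    then obtain y where y: "y \<in> T" "dist x y \<le> hausdorff_dist S T"
      using hausdorff_dist_attained[OF compact(1,2,4)] by blast
    have "x \<bullet> p \<le> y \<bullet> p + s * (r * norm p)" using y s(3) by (intro near) simp
    also have "r * norm p \<le> 1" using p direction[of p] unfolding polar_def by force
    then have "y \<bullet> p + s * (r * norm p) \<le> 1 + s * 1"
      using p y(1) s(1) by (intro add_mono mult_left_mono) (auto simp: polar_def)
    finally have xp: "x \<bullet> p \<le> 1 + s" by simp
    have "s / (1 - s) \<le> 1" using s(2) by (simp add: field_simps)
    then have "(1 - s / (1 - s)) * (x \<bullet> p) \<le> (1 - s / (1 - s)) * (1 + s)"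
      using xp by (intro mult_left_mono) auto
    also have "\<dots> \<le> 1" using s(1,2) by (simp add: field_simps)
    finally show "x \<bullet> ((1 - s / (1 - s)) *\<^sub>R p) \<le> 1" by simp
  qed
  ultimately show ?thesis by (auto simp: radially_close_def)
qed

context
  fixes A :: "real^'n^'n" and B :: "real^'m^'n" and C :: "((real^'n) \<times> (real^'m)) set"
    and P :: "(real^'n) set"
  assumes C: "proper_C_set C" and P: "proper_C_set P" and fixed: "P = set_dynamics A B C P"
begin

lemma C_set_fixed: "C_set P" "C_set (polar P)" "polar (polar P) = P"
  using P proper_C_set_polar[OF P] bipolar_C_set[of P] by (auto simp: proper_C_set_def)

lemma polar_step_fixed: "polar_step A B (polar C) (polar P) = polar P"
proof -
  have "C_set (polar_step A B (polar C) (polar P))"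
    using C_set_fixed(2) proper_C_set_polar[OF C] by (intro C_set_polar_step) (auto simp: proper_C_set_def)
  moreover have "polar (polar_step A B (polar C) (polar P)) = P"
    using set_dynamics_polar[OF C C_set_fixed(2), of A B] C_set_fixed(3) fixed by simp
  ultimately show ?thesis using bipolar_C_set by metis
qed

lemma attractive_fixed_point: "attractive_for_C_set_polars (set_dynamics A B C) P"
  unfolding attractive_for_C_set_polars_def
proof (intro allI impI)
  fix Q :: "(real^'n) set" assume Q: "C_set Q"
  let ?T = "polar_step A B (polar C)"
  obtain l where l: "0 < l" "l < 1"
    "\<And>k a b Q'. 0 \<le> a \<Longrightarrow> 0 \<le> b \<Longrightarrow> b \<le> 1 \<Longrightarrow> radially_close a b Q' (polar P) \<Longrightarrow>
       radially_close (l ^ k * a) (l ^ k * b) ((?T ^^ k) Q') (polar P)"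
    using polar_step_iterates_close[OF proper_C_set_polar[OF C] C_set_fixed(2) polar_step_fixed] by blast
  obtain r where r: "0 < r" "cball 0 r \<subseteq> polar P"
    using proper_C_set_polar[OF P] by (auto simp: proper_C_set_iff)
  obtain R where R: "0 < R" "P \<subseteq> cball 0 R" using C_set_subset_cball[OF C_set_fixed(1)] .
  obtain R' where R': "0 < R'" "Q \<subseteq> cball 0 R'" using C_set_subset_cball[OF Q] .
  define a where "a = R' / r"
  have "0 \<le> a" using r R' by (simp add: a_def)
  have "radially_close a 1 Q (polar P)"
  proof -
    have "q \<in> (*\<^sub>R) (1 + a) ` polar P" if "q \<in> Q" for q
    proof -
      have "norm q \<le> a * r" using R' r that by (auto simp: a_def)
      also have "\<dots> \<le> (1 + a) * r" using r(1) by simp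
      finally have "norm (q /\<^sub>R (1 + a)) \<le> r" using \<open>0 \<le> a\<close> by (simp add: field_simps)
      then have "q /\<^sub>R (1 + a) \<in> polar P" using r(2) by auto
      moreover have "q = (1 + a) *\<^sub>R (q /\<^sub>R (1 + a))" using \<open>0 \<le> a\<close> by simp
      ultimately show ?thesis by blast
    qed
    then show ?thesis using Q by (auto simp: radially_close_def C_set_def)
  qed
  then have close: "radially_close (l ^ k * a) (l ^ k) ((?T ^^ k) Q) (polar P)" for k
    using l(3)[of a 1 Q k] \<open>0 \<le> a\<close> by simp
  define S where "S k = (set_dynamics A B C ^^ Suc k) (polar Q)" for k
  have S: "S k = polar ((?T ^^ Suc k) Q)" for k
    unfolding S_def using set_dynamics_iterate[OF C Q] by blast
  have CS: "C_set (S k)" for k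
  proof -
    obtain \<rho> where "0 < \<rho>" "cball 0 \<rho> \<subseteq> polar C"
      using proper_C_set_polar[OF C] by (auto simp: proper_C_set_iff)
    moreover have "0 \<in> (?T ^^ k) Q" using set_dynamics_iterate[OF C Q, where A = A and B = B and k = k] by (simp add: C_set_def)
    ultimately show ?thesis
      unfolding S using C_set_polar[OF _ polar_step_contains_cball] by simp
  qed
  have pow: "(\<lambda>k. l ^ Suc k) \<longlonglongrightarrow> 0" using l(1,2) by (intro LIMSEQ_Suc LIMSEQ_realpow_zero) auto
  have "(\<lambda>k. hausdorff_dist (S k) P) \<longlonglongrightarrow> 0"
  proof (rule tendsto_sandwich)
    have "\<forall>\<^sub>F k in sequentially. l ^ Suc k < 1 / 2" using pow by (rule order_tendstoD) simp
    then show "\<forall>\<^sub>F k in sequentially. hausdorff_dist (S k) P \<le> (l ^ Suc k * a + 2 * l ^ Suc k) * R"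
    proof eventually_elim
      case (elim k)
      then show ?case
        using hausdorff_dist_polar_le[OF close, of "Suc k" R] l(1) \<open>0 \<le> a\<close> R(2)
        unfolding S by (simp add: C_set_fixed(3) del: power_Suc funpow.simps)
    qed
    show "\<forall>\<^sub>F k in sequentially. 0 \<le> hausdorff_dist (S k) P"
      by (simp add: hausdorff_dist_nonneg CS C_set_fixed(1))
    have "(\<lambda>k. (l ^ Suc k * a + 2 * l ^ Suc k) * R) \<longlonglongrightarrow> (0 * a + 2 * 0) * R"
      by (intro tendsto_intros pow)
    then show "(\<lambda>k. (l ^ Suc k * a + 2 * l ^ Suc k) * R) \<longlonglongrightarrow> 0" by simp
  qed simp
  then show "hausdorff_converges (\<lambda>k. (set_dynamics A B C ^^ Suc k) (polar Q)) P"
    using CS C_set_fixed(1) unfolding hausdorff_converges_def S_def[symmetric]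
    by (auto simp: convex_body_def C_set_def)
qed

lemma stable_fixed_point: "lyapunov_stable (set_dynamics A B C) P"
  unfolding lyapunov_stable_def
proof (intro allI impI)
  fix \<epsilon> :: real assume "\<epsilon> > 0"
  let ?T = "polar_step A B (polar C)"
  obtain l where l: "0 < l" "l < 1"
    "\<And>k a b Q'. 0 \<le> a \<Longrightarrow> 0 \<le> b \<Longrightarrow> b \<le> 1 \<Longrightarrow> radially_close a b Q' (polar P) \<Longrightarrow>
       radially_close (l ^ k * a) (l ^ k * b) ((?T ^^ k) Q') (polar P)"
    using polar_step_iterates_close[OF proper_C_set_polar[OF C] C_set_fixed(2) polar_step_fixed] by blast
  obtain r where r: "0 < r" "cball 0 r \<subseteq> P" using P by (auto simp: proper_C_set_iff)
  obtain R where R: "0 < R" "P \<subseteq> cball 0 R" using C_set_subset_cball[OF C_set_fixed(1)] .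
  define s where "s = min (1 / 3) (\<epsilon> / (6 * R))"
  define a where "a = s / (1 - s)"
  have s: "0 < s" "s \<le> 1 / 3" "6 * s * R \<le> \<epsilon>"
    using \<open>\<epsilon> > 0\<close> R(1) by (auto simp: s_def min_def field_simps)
  have "2 / 3 * a \<le> (1 - s) * a" using s by (intro mult_right_mono) (auto simp: a_def)
  then have a: "0 < a" "a \<le> 1 / 2" "2 * a \<le> 3 * s" using s by (auto simp: a_def field_simps)
  have "hausdorff_dist ((set_dynamics A B C ^^ k) P') P < \<epsilon>"
    if P': "proper_C_set P'" "hausdorff_dist P' P < s * r" for P' k
  proof -
    have C': "C_set P'" "C_set (polar P')"
      using P' proper_C_set_polar[of P'] by (auto simp: proper_C_set_def)
    have "radially_close a a (polar P') (polar P)"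
      unfolding a_def using C' C_set_fixed r s P' by (intro radially_close_polar) auto
    then have close: "radially_close (l ^ k * a) (l ^ k * a) ((?T ^^ k) (polar P')) (polar P)"
      using a by (intro l(3)) auto
    have la: "0 \<le> l ^ k * a" "l ^ k * a \<le> 1 * a"
      using l a by (auto intro!: mult_right_mono power_le_one)
    have "(set_dynamics A B C ^^ k) P' = polar ((?T ^^ k) (polar P'))"
      using set_dynamics_iterate[OF C C'(2), where A = A and B = B and k = k] by (simp add: bipolar_C_set C'(1))
    then have "hausdorff_dist ((set_dynamics A B C ^^ k) P') P \<le> (l ^ k * a + 2 * (l ^ k * a)) * R"
      using hausdorff_dist_polar_le[OF close la(1,1)] la a R(2) by (simp add: C_set_fixed(3))
    also have "\<dots> \<le> (3 * a) * R" using la R(1) by (intro mult_right_mono) linarith+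
    also have "\<dots> < (6 * s) * R" using a s R(1) by (intro mult_strict_right_mono) auto
    finally show ?thesis using s(3) by simp
  qed
  then show "\<exists>\<delta>>0. \<forall>P'. proper_C_set P' \<and> hausdorff_dist P' P < \<delta> \<longrightarrow>
      (\<forall>k. hausdorff_dist ((set_dynamics A B C ^^ k) P') P < \<epsilon>)"
    using s(1) r(1) by (intro exI[of _ "s * r"]) auto
qed

lemma fixed_point_unique:
  assumes P': "proper_C_set P'" "P' = set_dynamics A B C P'"
  shows "P' = P"
proof -
  have C': "C_set P'" "C_set (polar P')"
    using P' proper_C_set_polar[of P'] by (auto simp: proper_C_set_def)
  have "(set_dynamics A B C ^^ k) P' = P'" for k by (induction k) (use P'(2) in auto)
  then have "hausdorff_converges (\<lambda>k. P') P"
    using attractive_fixed_point[unfolded attractive_for_C_set_polars_def, rule_format, OF C'(2)]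
    by (simp only: bipolar_C_set[OF C'(1)])
  then have "hausdorff_dist P' P = 0" by (simp add: hausdorff_converges_def LIMSEQ_const_iff)
  then show ?thesis
    using hausdorff_dist_zero_subset C'(1) C_set_fixed(1) hausdorff_dist_commute by (metis subset_antisym)
qed

end

theorem theorem9:
  fixes A :: "real^'n^'n" and B :: "real^'m^'n"
    and C :: "((real^'n) \<times> (real^'m)) set"
  assumes "strictly_stabilizable A B"
    and "proper_C_set C"
  shows "(\<exists>!P. proper_C_set P \<and> P = set_dynamics A B C P) \<and>
         (\<forall>P. proper_C_set P \<and> P = set_dynamics A B C P \<longrightarrow>
            attractive_for_C_set_polars (set_dynamics A B C) P \<and>
            lyapunov_stable (set_dynamics A B C) P)"
proof -
  obtain Q where Q: "proper_C_set Q" "polar_step A B (polar C) Q = Q"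
    using polar_step_fixed_point_exists[OF assms(1) proper_C_set_polar[OF assms(2)]] .
  then have "proper_C_set (polar Q)" "polar Q = set_dynamics A B C (polar Q)"
    using set_dynamics_polar[OF assms(2), of Q A B] proper_C_set_polar[OF Q(1)]
    by (auto simp: proper_C_set_def)
  moreover have "P' = P"
    if "proper_C_set P \<and> P = set_dynamics A B C P" "proper_C_set P' \<and> P' = set_dynamics A B C P'" for P P'
    using fixed_point_unique[OF assms(2), where P = P and P' = P'] that by blast
  moreover have "attractive_for_C_set_polars (set_dynamics A B C) P" "lyapunov_stable (set_dynamics A B C) P"
    if "proper_C_set P \<and> P = set_dynamics A B C P" for P
    using attractive_fixed_point[OF assms(2), where P = P] stable_fixed_point[OF assms(2), where P = P] that by blast+
  ultimately show ?thesis by (intro conjI ex1I[of _ "polar Q"] allI impI) (assumption | blast)+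
qed

end
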